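(* Let $(E\xrightarrow{\delta}G\to\{1\},\{\,,\,\})$ be a braided crossed module and consider the crossed module $(\delta\colon E\to G,\triangleright')$, where $e\triangleright' k=k\{\delta(k)^{-1},e\}$. Given $x\in G$, define $\Phi^x=(\psi^x,\phi^x)$, with $\psi^x,\phi^x\colon G\times G\to E$, by $$\phi^x(L,M)=\{Mx^{-1},Lx^{-1}\},\qquad\psi^x(L,M)=\{xML^{-1}x^{-1}Lx^{-1},\,Lx^{-1}\}^{-1}.$$ Then $\Phi^x$ is a framed Reidemeister pair for $(\delta\colon E\to G,\triangleright')$, and constitutes a framed Eisermann lifting for $(G,x)$.
   Context: $[a,b]=aba^{-1}b^{-1}$. A braided crossed module $(E\xrightarrow{\delta}G\to1,\{\,,\,\})$ is a 2-crossed module whose last group is trivial; explicitly: a group morphism $\delta\colon E\to G$ and a map $\{\,,\,\}\colon G\times G\to E$ such that for all $e,f,g\in G$, $k,l\in E$: $\delta(\{e,f\})=[e,f]$; $\{\delta(l),\delta(k)\}=[l,k]$; $\{\delta(l),e\}\{e,\delta(l)\}=1$; $\{ef,g\}=\{e,fgf^{-1}\}\{f,g\}$; $\{e,fg\}=\{e,f\}\,(f\triangleright'\{e,g\})$, where $e\triangleright' l:=l\{\delta(l)^{-1},e\}$. It is known that $\triangleright'$ is a left action of $G$ on $E$ by automorphisms and that $(\delta\colon E\to G,\triangleright')$ is a crossed module. For a crossed module $(\mu\colon P\to H,\cdot)$ (group morphism $\mu$ with left action of $H$ on $P$ by automorphisms, $\mu(g\cdot e)=g\mu(e)g^{-1}$,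 $\mu(e)\cdot f=efe^{-1}$), functions $\psi,\phi\colon H\times H\to P$ form a framed Reidemeister pair if for all $X,Y,T\in H$: (R2) $\phi(X,Y)\psi(X,Z)=1$, where $Z=X^{-1}\mu(\phi(X,Y))^{-1}YX$; (R3) $\phi(Y,X)(Y\cdot\phi(T,Z))\phi(T,Y)=(X\cdot\phi(T,Y))\phi(T,X)(T\cdot\phi(V,W))$, where $Z=Y^{-1}\mu(\phi(Y,X))^{-1}XY$, $V=T^{-1}\mu(\phi(T,Y))^{-1}YT$, $W=T^{-1}\mu(\phi(T,X))^{-1}XT$; and moreover (i) for each $Z\in H$ the equation $\mu(\phi(A,Z))A=Z$ has a unique solution $A=f(Z)\in H$; (ii) with $g(A)=\mu(\psi(A,A))^{-1}A$ one has $f\circ g=g\circ f=\mathrm{id}_H$. A framed Eisermann lifting for $(H,x)$, $x\in H$, is a crossed module $(\mu\colon P\to H,\cdot)$ with a framed Reidemeister pair $(\psi^x,\phi^x)$ such that $\mu(\phi^x(L,M))=[Mx^{-1},Lx^{-1}]$ and $\mu(\psi^x(L,M))=[xML^{-1}x^{-1}Lx^{-1},Lx^{-1}]^{-1}$ for all $L,M\in H$. *)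

theory Defs
  imports "HOL-Algebra.Group"
begin

definition commutator :: "('a, 'm) monoid_scheme \<Rightarrow> 'a \<Rightarrow> 'a \<Rightarrow> 'a" where
  "commutator G a b = a \<otimes>\<^bsub>G\<^esub> b \<otimes>\<^bsub>G\<^esub> inv\<^bsub>G\<^esub> a \<otimes>\<^bsub>G\<^esub> inv\<^bsub>G\<^esub> b"

locale crossed_module = group_hom P H bd
  for P :: "('p, 'm) monoid_scheme" and H :: "('h, 'n) monoid_scheme" and bd :: "'p \<Rightarrow> 'h" +
  fixes act :: "'h \<Rightarrow> 'p \<Rightarrow> 'p"
  assumes act_automorphism: "g \<in> carrier H \<Longrightarrow> act g \<in> iso P P"
    and act_one: "e \<in> carrier P \<Longrightarrow> act \<one>\<^bsub>H\<^esub> e = e"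
    and act_mult: "\<lbrakk>g \<in> carrier H; h \<in> carrier H; e \<in> carrier P\<rbrakk>
      \<Longrightarrow> act (g \<otimes>\<^bsub>H\<^esub> h) e = act g (act h e)"
    and equivariance: "\<lbrakk>g \<in> carrier H; e \<in> carrier P\<rbrakk>
      \<Longrightarrow> bd (act g e) = g \<otimes>\<^bsub>H\<^esub> bd e \<otimes>\<^bsub>H\<^esub> inv\<^bsub>H\<^esub> g"
    and peiffer: "\<lbrakk>e \<in> carrier P; f \<in> carrier P\<rbrakk>
      \<Longrightarrow> act (bd e) f = e \<otimes>\<^bsub>P\<^esub> f \<otimes>\<^bsub>P\<^esub> inv\<^bsub>P\<^esub> e"

text \<open>The action \<open>\<triangleright>'\<close> of the base group on the top group induced by a braiding.\<close>

definition braiding_act ::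
  "('e, 'm) monoid_scheme \<Rightarrow> ('g, 'n) monoid_scheme \<Rightarrow> ('e \<Rightarrow> 'g) \<Rightarrow> ('g \<Rightarrow> 'g \<Rightarrow> 'e)
    \<Rightarrow> 'g \<Rightarrow> 'e \<Rightarrow> 'e" where
  "braiding_act E G \<delta> br e l = l \<otimes>\<^bsub>E\<^esub> br (inv\<^bsub>G\<^esub> (\<delta> l)) e"

locale braided_crossed_module = group_hom E G \<delta>
  for E :: "('e, 'm) monoid_scheme" and G :: "('g, 'n) monoid_scheme" and \<delta> :: "'e \<Rightarrow> 'g" +
  fixes br :: "'g \<Rightarrow> 'g \<Rightarrow> 'e"
  assumes br_closed: "\<lbrakk>e \<in> carrier G; f \<in> carrier G\<rbrakk> \<Longrightarrow> br e f \<in> carrier E"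
    and boundary_br: "\<lbrakk>e \<in> carrier G; f \<in> carrier G\<rbrakk> \<Longrightarrow> \<delta> (br e f) = commutator G e f"
    and br_boundary: "\<lbrakk>l \<in> carrier E; k \<in> carrier E\<rbrakk> \<Longrightarrow> br (\<delta> l) (\<delta> k) = commutator E l k"
    and br_boundary_inverse: "\<lbrakk>l \<in> carrier E; e \<in> carrier G\<rbrakk>
      \<Longrightarrow> br (\<delta> l) e \<otimes>\<^bsub>E\<^esub> br e (\<delta> l) = \<one>\<^bsub>E\<^esub>"
    and br_mult_left: "\<lbrakk>e \<in> carrier G; f \<in> carrier G; g \<in> carrier G\<rbrakk>
      \<Longrightarrow> br (e \<otimes>\<^bsub>G\<^esub> f) g = br e (f \<otimes>\<^bsub>G\<^esub> g \<otimes>\<^bsub>G\<^esub> inv\<^bsub>G\<^esub> f) \<otimes>\<^bsub>E\<^esub> br f g"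
    and br_mult_right: "\<lbrakk>e \<in> carrier G; f \<in> carrier G; g \<in> carrier G\<rbrakk>
      \<Longrightarrow> br e (f \<otimes>\<^bsub>G\<^esub> g) = br e f \<otimes>\<^bsub>E\<^esub> braiding_act E G \<delta> br f (br e g)"

text \<open>For a pair \<open>(\<psi>, \<phi>)\<close>: \<open>under_colour\<close> is the colour \<open>Z\<close> (also \<open>V\<close>, \<open>W\<close>) determined by
  \<open>X\<close> and \<open>Y\<close>; \<open>kink_f\<close> and \<open>kink_g\<close> are the maps \<open>f\<close> and \<open>g\<close> whose mutual inverseness is the
  framed Reidemeister I condition. The description defining \<open>kink_f\<close> is meaningful only under
  the unique-solvability condition, which is assumed alongside it below.\<close>

definition under_colour ::
  "('h, 'n) monoid_scheme \<Rightarrow> ('p \<Rightarrow> 'h) \<Rightarrow> ('h \<Rightarrow> 'h \<Rightarrow> 'p) \<Rightarrow> 'h \<Rightarrow> 'h \<Rightarrow> 'h" where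
  "under_colour H bd \<phi> X Y =
    inv\<^bsub>H\<^esub> X \<otimes>\<^bsub>H\<^esub> inv\<^bsub>H\<^esub> (bd (\<phi> X Y)) \<otimes>\<^bsub>H\<^esub> Y \<otimes>\<^bsub>H\<^esub> X"

definition kink_f ::
  "('h, 'n) monoid_scheme \<Rightarrow> ('p \<Rightarrow> 'h) \<Rightarrow> ('h \<Rightarrow> 'h \<Rightarrow> 'p) \<Rightarrow> 'h \<Rightarrow> 'h" where
  "kink_f H bd \<phi> Z = (THE A. A \<in> carrier H \<and> bd (\<phi> A Z) \<otimes>\<^bsub>H\<^esub> A = Z)"

definition kink_g ::
  "('h, 'n) monoid_scheme \<Rightarrow> ('p \<Rightarrow> 'h) \<Rightarrow> ('h \<Rightarrow> 'h \<Rightarrow> 'p) \<Rightarrow> 'h \<Rightarrow> 'h" where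
  "kink_g H bd \<psi> A = inv\<^bsub>H\<^esub> (bd (\<psi> A A)) \<otimes>\<^bsub>H\<^esub> A"

locale framed_reidemeister_pair = crossed_module P H bd act
  for P :: "('p, 'm) monoid_scheme" and H :: "('h, 'n) monoid_scheme" and bd :: "'p \<Rightarrow> 'h"
    and act :: "'h \<Rightarrow> 'p \<Rightarrow> 'p" +
  fixes \<psi> \<phi> :: "'h \<Rightarrow> 'h \<Rightarrow> 'p"
  assumes psi_closed: "\<lbrakk>X \<in> carrier H; Y \<in> carrier H\<rbrakk> \<Longrightarrow> \<psi> X Y \<in> carrier P"
    and phi_closed: "\<lbrakk>X \<in> carrier H; Y \<in> carrier H\<rbrakk> \<Longrightarrow> \<phi> X Y \<in> carrier P"
    and R2: "\<lbrakk>X \<in> carrier H; Y \<in> carrier H; Z = under_colour H bd \<phi> X Y\<rbrakk>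
      \<Longrightarrow> \<phi> X Y \<otimes>\<^bsub>P\<^esub> \<psi> X Z = \<one>\<^bsub>P\<^esub>"
    and R3: "\<lbrakk>X \<in> carrier H; Y \<in> carrier H; T \<in> carrier H;
        Z = under_colour H bd \<phi> Y X; V = under_colour H bd \<phi> T Y; W = under_colour H bd \<phi> T X\<rbrakk>
      \<Longrightarrow> \<phi> Y X \<otimes>\<^bsub>P\<^esub> act Y (\<phi> T Z) \<otimes>\<^bsub>P\<^esub> \<phi> T Y
        = act X (\<phi> T Y) \<otimes>\<^bsub>P\<^esub> \<phi> T X \<otimes>\<^bsub>P\<^esub> act T (\<phi> V W)"
    and kink_unique: "Z \<in> carrier H
      \<Longrightarrow> \<exists>!A. A \<in> carrier H \<and> bd (\<phi> A Z) \<otimes>\<^bsub>H\<^esub> A = Z"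
    and kink_f_g: "A \<in> carrier H \<Longrightarrow> kink_f H bd \<phi> (kink_g H bd \<psi> A) = A"
    and kink_g_f: "A \<in> carrier H \<Longrightarrow> kink_g H bd \<psi> (kink_f H bd \<phi> A) = A"

locale framed_eisermann_lifting = framed_reidemeister_pair P H bd act \<psi> \<phi>
  for P :: "('p, 'm) monoid_scheme" and H :: "('h, 'n) monoid_scheme" and bd :: "'p \<Rightarrow> 'h"
    and act :: "'h \<Rightarrow> 'p \<Rightarrow> 'p" and \<psi> \<phi> :: "'h \<Rightarrow> 'h \<Rightarrow> 'p" +
  fixes x :: 'h
  assumes x_closed: "x \<in> carrier H"
    and boundary_phi: "\<lbrakk>L \<in> carrier H; M \<in> carrier H\<rbrakk>
      \<Longrightarrow> bd (\<phi> L M) = commutator H (M \<otimes>\<^bsub>H\<^esub> inv\<^bsub>H\<^esub> x) (L \<otimes>\<^bsub>H\<^esub> inv\<^bsub>H\<^esub> x)"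
    and boundary_psi: "\<lbrakk>L \<in> carrier H; M \<in> carrier H\<rbrakk>
      \<Longrightarrow> bd (\<psi> L M) = inv\<^bsub>H\<^esub> (commutator H
        (x \<otimes>\<^bsub>H\<^esub> M \<otimes>\<^bsub>H\<^esub> inv\<^bsub>H\<^esub> L \<otimes>\<^bsub>H\<^esub> inv\<^bsub>H\<^esub> x \<otimes>\<^bsub>H\<^esub> L \<otimes>\<^bsub>H\<^esub> inv\<^bsub>H\<^esub> x)
        (L \<otimes>\<^bsub>H\<^esub> inv\<^bsub>H\<^esub> x))"

definition braiding_phi ::
  "('g, 'n) monoid_scheme \<Rightarrow> ('g \<Rightarrow> 'g \<Rightarrow> 'e) \<Rightarrow> 'g \<Rightarrow> 'g \<Rightarrow> 'g \<Rightarrow> 'e" where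
  "braiding_phi G br x L M = br (M \<otimes>\<^bsub>G\<^esub> inv\<^bsub>G\<^esub> x) (L \<otimes>\<^bsub>G\<^esub> inv\<^bsub>G\<^esub> x)"

definition braiding_psi ::
  "('e, 'm) monoid_scheme \<Rightarrow> ('g, 'n) monoid_scheme \<Rightarrow> ('g \<Rightarrow> 'g \<Rightarrow> 'e) \<Rightarrow> 'g \<Rightarrow> 'g \<Rightarrow> 'g \<Rightarrow> 'e" where
  "braiding_psi E G br x L M = inv\<^bsub>E\<^esub> (br
    (x \<otimes>\<^bsub>G\<^esub> M \<otimes>\<^bsub>G\<^esub> inv\<^bsub>G\<^esub> L \<otimes>\<^bsub>G\<^esub> inv\<^bsub>G\<^esub> x \<otimes>\<^bsub>G\<^esub> L \<otimes>\<^bsub>G\<^esub> inv\<^bsub>G\<^esub> x)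
    (L \<otimes>\<^bsub>G\<^esub> inv\<^bsub>G\<^esub> x))"

end

(* The braiding satisfies {ef,g} = (e |> {f,g}) {e,g} and x |> {e,f} = {xex^-1, xfx^-1}.
   In terms of a = Xx^-1, b = Yx^-1, t = Tx^-1, these reduce (R3) to the relation
   {w,bw} = {b,w}^-1 for w = [t^-1,x]. It fails for general w, where {w,w} survives, but this w
   is the boundary of {t^-1,x}, and on the image of the boundary {w,w} is trivial and {w,b} is
   inverse to {b,w}. (R2) is a computation in G, and both kink maps are the identity. *)
theory Submission
  imports Defs
begin

text \<open>With associativity and the rule for the inverse of a product, these let
  \<open>simp\<close> reduce group words to normal form.\<close>

lemma (in group) inv_m_cancel [simp]:
  "\<lbrakk>a \<in> carrier G; b \<in> carrier G\<rbrakk> \<Longrightarrow> inv a \<otimes> (a \<otimes> b) = b"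
  "\<lbrakk>a \<in> carrier G; b \<in> carrier G\<rbrakk> \<Longrightarrow> a \<otimes> (inv a \<otimes> b) = b"
  by (simp_all flip: m_assoc)

context braided_crossed_module
begin

section \<open>The action induced by a braiding and its crossed module\<close>

abbreviation act (infixr "\<rhd>" 75)
  where "g \<rhd> l \<equiv> braiding_act E G \<delta> br g l"

lemmas [simp] = br_closed
text \<open>The prefixes come from \<open>group_hom\<close>: \<open>G.\<close> marks facts about the
  group \<open>E\<close>, and \<open>H.\<close> facts about the group \<open>G\<close>.\<close>

lemmas gsimps = G.m_assoc H.m_assoc G.inv_mult_group H.inv_mult_group commutator_def

lemma act_closed [simp]: "\<lbrakk>g \<in> carrier G; l \<in> carrier E\<rbrakk> \<Longrightarrow> g \<rhd> l \<in> carrier E"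
  by (simp add: braiding_act_def)

lemma br_one_left [simp]:
  assumes "g \<in> carrier G" shows "br \<one>\<^bsub>G\<^esub> g = \<one>\<^bsub>E\<^esub>"
  using br_mult_left[of "\<one>\<^bsub>G\<^esub>" "\<one>\<^bsub>G\<^esub>" g] assms by simp

text \<open>As {e,1} has trivial boundary, acting on it by 1 only multiplies it by {1,1} = 1; the
  right product axiom then makes {e,1} idempotent.\<close>

lemma br_one_right [simp]:
  assumes "e \<in> carrier G" shows "br e \<one>\<^bsub>G\<^esub> = \<one>\<^bsub>E\<^esub>"
  using br_mult_right[of e "\<one>\<^bsub>G\<^esub>" "\<one>\<^bsub>G\<^esub>"] assms
  by (simp add: braiding_act_def boundary_br commutator_def)

lemma act_by_one [simp]: "l \<in> carrier E \<Longrightarrow> \<one>\<^bsub>G\<^esub> \<rhd> l = l"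
  by (simp add: braiding_act_def)

text \<open>The Peiffer identity, from \<open>l [l^-1, c] = c l c^-1\<close>.\<close>

lemma act_boundary:
  "\<lbrakk>c \<in> carrier E; l \<in> carrier E\<rbrakk> \<Longrightarrow> \<delta> c \<rhd> l = c \<otimes>\<^bsub>E\<^esub> l \<otimes>\<^bsub>E\<^esub> inv\<^bsub>E\<^esub> c"
  using br_boundary[of "inv\<^bsub>E\<^esub> l" c] by (simp add: braiding_act_def gsimps)

lemma boundary_act:
  "\<lbrakk>g \<in> carrier G; l \<in> carrier E\<rbrakk> \<Longrightarrow> \<delta> (g \<rhd> l) = g \<otimes>\<^bsub>G\<^esub> \<delta> l \<otimes>\<^bsub>G\<^esub> inv\<^bsub>G\<^esub> g"
  by (simp add: braiding_act_def boundary_br gsimps)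

lemma br_boundary_mult_right:
  assumes "e \<in> carrier G" "c \<in> carrier E" "h \<in> carrier G"
  shows "br e (\<delta> c \<otimes>\<^bsub>G\<^esub> h) = br e (\<delta> c) \<otimes>\<^bsub>E\<^esub> c \<otimes>\<^bsub>E\<^esub> br e h \<otimes>\<^bsub>E\<^esub> inv\<^bsub>E\<^esub> c"
  using assms by (simp add: br_mult_right act_boundary G.m_assoc)

text \<open>The action law in general needs that \<open>G\<close> acts by homomorphisms, whose proof in turn needs
  this case of it.\<close>

lemma act_boundary_mult:
  assumes "c \<in> carrier E" "h \<in> carrier G" "l \<in> carrier E"
  shows "(\<delta> c \<otimes>\<^bsub>G\<^esub> h) \<rhd> l = c \<otimes>\<^bsub>E\<^esub> (h \<rhd> l) \<otimes>\<^bsub>E\<^esub> inv\<^bsub>E\<^esub> c"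
proof -
  \<comment> \<open>Since \<open>l [l^-1, c] c = c l\<close>, the expansion of
    \<open>l {\<delta>(l)^-1, \<delta>(c) h}\<close> becomes
    \<open>c l {\<delta>(l)^-1, h} c^-1\<close>.\<close>
  have "br (inv\<^bsub>G\<^esub> (\<delta> l)) (\<delta> c) = commutator E (inv\<^bsub>E\<^esub> l) c"
    using assms br_boundary[of "inv\<^bsub>E\<^esub> l" c] by simp
  then show ?thesis
    using assms by (simp add: braiding_act_def br_boundary_mult_right gsimps)
qed

lemma act_hom:
  assumes "g \<in> carrier G" "k \<in> carrier E" "l \<in> carrier E"
  shows "g \<rhd> (k \<otimes>\<^bsub>E\<^esub> l) = (g \<rhd> k) \<otimes>\<^bsub>E\<^esub> (g \<rhd> l)"
proof -
  \<comment> \<open>The left product axiom splits \<open>{\<delta>(kl)^-1, g}\<close> into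
    \<open>{\<delta>(l)^-1, \<delta>(k)^-1 g \<delta>(k)} c\<close>. The conjugate of g equals
    \<open>\<delta>(c) g\<close>, and the \<open>c^-1\<close> from \<open>act_boundary_mult\<close>
    cancels the last c.\<close>
  let ?c = "br (inv\<^bsub>G\<^esub> (\<delta> k)) g"
  have "inv\<^bsub>G\<^esub> (\<delta> k) \<otimes>\<^bsub>G\<^esub> g \<otimes>\<^bsub>G\<^esub> \<delta> k = \<delta> ?c \<otimes>\<^bsub>G\<^esub> g"
    using assms by (simp add: boundary_br gsimps)
  then have "g \<rhd> (k \<otimes>\<^bsub>E\<^esub> l) = k \<otimes>\<^bsub>E\<^esub> ((\<delta> ?c \<otimes>\<^bsub>G\<^esub> g) \<rhd> l) \<otimes>\<^bsub>E\<^esub> ?c"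
    using assms by (simp add: braiding_act_def br_mult_left G.m_assoc H.inv_mult_group)
  also have "\<dots> = (g \<rhd> k) \<otimes>\<^bsub>E\<^esub> (g \<rhd> l)"
    using assms by (simp add: act_boundary_mult) (simp add: braiding_act_def G.m_assoc)
  finally show ?thesis .
qed

text \<open>The right product axiom gives
  \<open>(g \<rhd> l) (g \<rhd> {\<delta>(l)^-1, h})\<close>, which recombines because g acts by a
  homomorphism.\<close>

lemma act_mult:
  assumes "g \<in> carrier G" "h \<in> carrier G" "l \<in> carrier E"
  shows "(g \<otimes>\<^bsub>G\<^esub> h) \<rhd> l = g \<rhd> h \<rhd> l"
proof -
  have "(g \<otimes>\<^bsub>G\<^esub> h) \<rhd> l = (g \<rhd> l) \<otimes>\<^bsub>E\<^esub> (g \<rhd> br (inv\<^bsub>G\<^esub> (\<delta> l)) h)"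
    using assms by (simp add: braiding_act_def[of _ _ _ _ _ l] br_mult_right G.m_assoc)
  also have "\<dots> = g \<rhd> h \<rhd> l"
    using assms by (simp add: braiding_act_def[of _ _ _ _ h l] act_hom)
  finally show ?thesis .
qed

lemma act_group_hom: "g \<in> carrier G \<Longrightarrow> group_hom E E (act g)"
  by unfold_locales (auto simp: hom_def act_hom)

lemma act_inv:
  "\<lbrakk>g \<in> carrier G; l \<in> carrier E\<rbrakk> \<Longrightarrow> g \<rhd> inv\<^bsub>E\<^esub> l = inv\<^bsub>E\<^esub> (g \<rhd> l)"
  by (rule group_hom.hom_inv[OF act_group_hom])

lemma act_iso: "g \<in> carrier G \<Longrightarrow> act g \<in> iso E E"
  by (auto simp: iso_def hom_def act_hom simp flip: act_mult
      intro!: bij_betw_byWitness[where f' = "act (inv\<^bsub>G\<^esub> g)"])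

lemma crossed_module_act: "crossed_module E G \<delta> act"
  by unfold_locales
    (simp_all add: act_iso act_mult boundary_act act_boundary)

section \<open>Further product and conjugation laws of the braiding\<close>

lemma act_eq_br_boundary:
  assumes "e \<in> carrier G" "l \<in> carrier E"
  shows "e \<rhd> l = br e (\<delta> l) \<otimes>\<^bsub>E\<^esub> l"
proof -
  \<comment> \<open>Acting on \<open>l^-1\<close> puts \<open>\<delta>(l)\<close> itself into the
    first slot, from where the axiom on \<open>{\<delta>(l), e} {e, \<delta>(l)}\<close> moves it to
    the second.\<close>
  have "inv\<^bsub>E\<^esub> (e \<rhd> l) = inv\<^bsub>E\<^esub> l \<otimes>\<^bsub>E\<^esub> br (\<delta> l) e"
    using assms act_inv[of e l] by (simp add: braiding_act_def)
  moreover have "br (\<delta> l) e = inv\<^bsub>E\<^esub> (br e (\<delta> l))"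
    using assms br_boundary_inverse[of l e] by (simp add: G.inv_equality)
  ultimately have "inv\<^bsub>E\<^esub> (e \<rhd> l) = inv\<^bsub>E\<^esub> (br e (\<delta> l) \<otimes>\<^bsub>E\<^esub> l)"
    using assms by (simp add: G.inv_mult_group)
  then show ?thesis
    using assms by (metis G.inv_inv G.m_closed act_closed br_closed hom_closed)
qed

lemma br_boundary_mult_right_act:
  assumes "e \<in> carrier G" "c \<in> carrier E" "h \<in> carrier G"
  shows "br e (\<delta> c \<otimes>\<^bsub>G\<^esub> h) = (e \<rhd> c) \<otimes>\<^bsub>E\<^esub> br e h \<otimes>\<^bsub>E\<^esub> inv\<^bsub>E\<^esub> c"
  using assms by (simp add: br_boundary_mult_right act_eq_br_boundary)

lemma br_mult_left_act:
  assumes "e \<in> carrier G" "f \<in> carrier G" "g \<in> carrier G"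
  shows "br (e \<otimes>\<^bsub>G\<^esub> f) g = (e \<rhd> br f g) \<otimes>\<^bsub>E\<^esub> br e g"
proof -
  \<comment> \<open>The conjugate in the left product axiom is g times a boundary. Taking that
    boundary out of the second slot leaves \<open>{f,g}^-1\<close>, which cancels the factor {f,g}
    of the axiom.\<close>
  have "f \<otimes>\<^bsub>G\<^esub> g \<otimes>\<^bsub>G\<^esub> inv\<^bsub>G\<^esub> f = \<delta> (br f g) \<otimes>\<^bsub>G\<^esub> g"
    using assms by (simp add: boundary_br gsimps)
  then show ?thesis
    using assms by (simp add: br_mult_left br_boundary_mult_right_act G.m_assoc)
qed

text \<open>Multiplied by {x,f} on the right, both sides are {xe,f}: the word xe is split as
  \<open>(x e x^-1) x\<close> by the axiom and as \<open>x e\<close> by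
  \<open>br_mult_left_act\<close>.\<close>

lemma act_br:
  assumes "x \<in> carrier G" "e \<in> carrier G" "f \<in> carrier G"
  shows "x \<rhd> br e f = br (x \<otimes>\<^bsub>G\<^esub> e \<otimes>\<^bsub>G\<^esub> inv\<^bsub>G\<^esub> x) (x \<otimes>\<^bsub>G\<^esub> f \<otimes>\<^bsub>G\<^esub> inv\<^bsub>G\<^esub> x)"
proof -
  have "br (x \<otimes>\<^bsub>G\<^esub> e \<otimes>\<^bsub>G\<^esub> inv\<^bsub>G\<^esub> x) (x \<otimes>\<^bsub>G\<^esub> f \<otimes>\<^bsub>G\<^esub> inv\<^bsub>G\<^esub> x) \<otimes>\<^bsub>E\<^esub> br x f
      = br (x \<otimes>\<^bsub>G\<^esub> e) f"
    using assms br_mult_left[of "x \<otimes>\<^bsub>G\<^esub> e \<otimes>\<^bsub>G\<^esub> inv\<^bsub>G\<^esub> x" x f] by (simp add: H.m_assoc)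
  also have "\<dots> = (x \<rhd> br e f) \<otimes>\<^bsub>E\<^esub> br x f"
    using assms by (rule br_mult_left_act)
  finally show ?thesis
    using assms by simp
qed

section \<open>Relations behind the third Reidemeister move\<close>

lemma br_act_swap:
  assumes "a \<in> carrier G" "b \<in> carrier G" "k \<in> carrier E"
  shows "br a b \<otimes>\<^bsub>E\<^esub> (b \<rhd> a \<rhd> k) = (a \<rhd> b \<rhd> k) \<otimes>\<^bsub>E\<^esub> br a b"
proof -
  \<comment> \<open>The words ab and ba differ by the boundary of {a,b}, so their actions differ by
    conjugation with {a,b}.\<close>
  have "a \<otimes>\<^bsub>G\<^esub> b = \<delta> (br a b) \<otimes>\<^bsub>G\<^esub> (b \<otimes>\<^bsub>G\<^esub> a)"
    using assms by (simp add: boundary_br gsimps)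
  then have "a \<rhd> b \<rhd> k = br a b \<otimes>\<^bsub>E\<^esub> (b \<rhd> a \<rhd> k) \<otimes>\<^bsub>E\<^esub> inv\<^bsub>E\<^esub> (br a b)"
    using assms by (simp add: act_boundary_mult flip: act_mult)
  then show ?thesis
    using assms by (simp add: G.m_assoc)
qed

text \<open>For \<open>w = \<delta>(l)\<close> the right product axiom gives
  \<open>{w,b} (b \<rhd> {w,w})\<close>, and \<open>{w,w} = [l,l]\<close>.\<close>

lemma br_boundary_self:
  assumes "b \<in> carrier G" "l \<in> carrier E"
  shows "br (\<delta> l) (b \<otimes>\<^bsub>G\<^esub> \<delta> l) = inv\<^bsub>E\<^esub> (br b (\<delta> l))"
proof -
  have "br (\<delta> l) (\<delta> l) = \<one>\<^bsub>E\<^esub>"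
    using assms by (simp add: br_boundary gsimps)
  moreover have "b \<rhd> \<one>\<^bsub>E\<^esub> = \<one>\<^bsub>E\<^esub>"
    using assms by (simp add: braiding_act_def)
  ultimately show ?thesis
    using assms br_boundary_inverse[of l b] by (simp add: br_mult_right G.inv_equality)
qed

text \<open>In \<open>{a,bu} = {a,b} (b \<rhd> {a,u})\<close> the last factor is expanded along
  \<open>a = (a b^-1) b\<close>; then {a,b} is moved past one factor by
  \<open>br_act_swap\<close>.\<close>

lemma br_mult_right_div:
  assumes "a \<in> carrier G" "b \<in> carrier G" "u \<in> carrier G"
  shows "br a b \<otimes>\<^bsub>E\<^esub> (b \<rhd> br (a \<otimes>\<^bsub>G\<^esub> inv\<^bsub>G\<^esub> b) u)
    = inv\<^bsub>E\<^esub> (a \<rhd> br b u) \<otimes>\<^bsub>E\<^esub> br a (b \<otimes>\<^bsub>G\<^esub> u)"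
proof -
  let ?k = "inv\<^bsub>G\<^esub> b \<rhd> br b u"
  have k: "b \<rhd> ?k = br b u"
    using assms by (simp flip: act_mult)
  have "br a u = (a \<rhd> ?k) \<otimes>\<^bsub>E\<^esub> br (a \<otimes>\<^bsub>G\<^esub> inv\<^bsub>G\<^esub> b) u"
    using assms br_mult_left_act[of "a \<otimes>\<^bsub>G\<^esub> inv\<^bsub>G\<^esub> b" b u] by (simp add: H.m_assoc act_mult)
  then have "br a (b \<otimes>\<^bsub>G\<^esub> u)
      = (br a b \<otimes>\<^bsub>E\<^esub> (b \<rhd> a \<rhd> ?k)) \<otimes>\<^bsub>E\<^esub> (b \<rhd> br (a \<otimes>\<^bsub>G\<^esub> inv\<^bsub>G\<^esub> b) u)"
    using assms by (simp add: br_mult_right act_hom G.m_assoc)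
  also have "\<dots> = (a \<rhd> br b u) \<otimes>\<^bsub>E\<^esub> (br a b \<otimes>\<^bsub>E\<^esub> (b \<rhd> br (a \<otimes>\<^bsub>G\<^esub> inv\<^bsub>G\<^esub> b) u))"
    using assms by (simp add: br_act_swap k G.m_assoc)
  finally show ?thesis
    using assms by simp
qed

text \<open>Condition (R3) for \<open>a = Xx\<^sup>-\<^sup>1\<close>, \<open>b = Yx\<^sup>-\<^sup>1\<close>, \<open>t = Tx\<^sup>-\<^sup>1\<close>, \<open>v = xbx\<^sup>-\<^sup>1\<close> and
  \<open>\<delta> l = [t\<^sup>-\<^sup>1, x]\<close>, so that \<open>u = xtx\<^sup>-\<^sup>1\<close>.\<close>

lemma br_hexagon:
  assumes [simp]: "a \<in> carrier G" "b \<in> carrier G" "t \<in> carrier G" "v \<in> carrier G" "l \<in> carrier E"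
  defines "u \<equiv> t \<otimes>\<^bsub>G\<^esub> \<delta> l"
  shows "br a b \<otimes>\<^bsub>E\<^esub> (b \<rhd> br (a \<otimes>\<^bsub>G\<^esub> inv\<^bsub>G\<^esub> b \<otimes>\<^bsub>G\<^esub> v) u) \<otimes>\<^bsub>E\<^esub> br b t
    = (a \<rhd> br v u) \<otimes>\<^bsub>E\<^esub> br a t \<otimes>\<^bsub>E\<^esub> (t \<rhd> br (a \<otimes>\<^bsub>G\<^esub> \<delta> l) (b \<otimes>\<^bsub>G\<^esub> \<delta> l))"
proof -
  \<comment> \<open>\<open>?k\<close> is the element that b carries to {v,u}, which prepares
    \<open>br_act_swap\<close>. Both sides will be brought to a form ending in
    \<open>br a ?s\<close>.\<close>
  let ?k = "inv\<^bsub>G\<^esub> b \<rhd> br v u" and ?s = "t \<otimes>\<^bsub>G\<^esub> (b \<otimes>\<^bsub>G\<^esub> \<delta> l)"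
  have [simp]: "u \<in> carrier G"
    by (simp add: u_def)
  have k: "b \<rhd> ?k = br v u"
    by (simp flip: act_mult)
  \<comment> \<open>The commutator [b,t], taken out of the second slot of \<open>br a (b u)\<close>,
    contributes \<open>a \<rhd> {b,t}\<close> and \<open>{b,t}^-1\<close>. The latter cancels the
    last factor of the left side, the former a part of \<open>a \<rhd> {b,u}\<close>.\<close>
  have bu: "b \<otimes>\<^bsub>G\<^esub> u = \<delta> (br b t) \<otimes>\<^bsub>G\<^esub> ?s"
    by (simp add: u_def boundary_br gsimps)
  have "br a b \<otimes>\<^bsub>E\<^esub> (b \<rhd> br (a \<otimes>\<^bsub>G\<^esub> inv\<^bsub>G\<^esub> b \<otimes>\<^bsub>G\<^esub> v) u)
      = (br a b \<otimes>\<^bsub>E\<^esub> (b \<rhd> a \<rhd> ?k)) \<otimes>\<^bsub>E\<^esub> (b \<rhd> br (a \<otimes>\<^bsub>G\<^esub> inv\<^bsub>G\<^esub> b) u)"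
    by (simp add: br_mult_left_act[of "a \<otimes>\<^bsub>G\<^esub> inv\<^bsub>G\<^esub> b"] act_hom act_mult G.m_assoc)
  also have "\<dots> = (a \<rhd> br v u) \<otimes>\<^bsub>E\<^esub> inv\<^bsub>E\<^esub> (a \<rhd> br b u) \<otimes>\<^bsub>E\<^esub> br a (b \<otimes>\<^bsub>G\<^esub> u)"
    by (simp add: br_act_swap k G.m_assoc br_mult_right_div)
  finally have lhs: "br a b \<otimes>\<^bsub>E\<^esub> (b \<rhd> br (a \<otimes>\<^bsub>G\<^esub> inv\<^bsub>G\<^esub> b \<otimes>\<^bsub>G\<^esub> v) u) \<otimes>\<^bsub>E\<^esub> br b t
      = (a \<rhd> br v u) \<otimes>\<^bsub>E\<^esub> inv\<^bsub>E\<^esub> (a \<rhd> t \<rhd> br b (\<delta> l)) \<otimes>\<^bsub>E\<^esub> br a ?s"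
    unfolding bu by (simp add: br_boundary_mult_right_act G.m_assoc)
      (simp add: u_def br_mult_right act_hom G.m_assoc G.inv_mult_group)
  have "br a t \<otimes>\<^bsub>E\<^esub> (t \<rhd> br (a \<otimes>\<^bsub>G\<^esub> \<delta> l) (b \<otimes>\<^bsub>G\<^esub> \<delta> l))
      = (br a t \<otimes>\<^bsub>E\<^esub> (t \<rhd> a \<rhd> br (\<delta> l) (b \<otimes>\<^bsub>G\<^esub> \<delta> l))) \<otimes>\<^bsub>E\<^esub> (t \<rhd> br a (b \<otimes>\<^bsub>G\<^esub> \<delta> l))"
    by (simp add: br_mult_left_act act_hom G.m_assoc)
  also have "\<dots> = (a \<rhd> t \<rhd> br (\<delta> l) (b \<otimes>\<^bsub>G\<^esub> \<delta> l)) \<otimes>\<^bsub>E\<^esub> br a ?s"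
    by (subst br_act_swap) (simp_all add: br_mult_right[of a t] G.m_assoc)
  \<comment> \<open>All that is left to compare is {w,bw} with \<open>{b,w}^-1\<close>, for
    \<open>w = \<delta>(l)\<close>, under the action of a and t.\<close>
  also have "\<dots> = inv\<^bsub>E\<^esub> (a \<rhd> t \<rhd> br b (\<delta> l)) \<otimes>\<^bsub>E\<^esub> br a ?s"
    by (simp add: br_boundary_self act_inv)
  finally show ?thesis
    by (simp add: lhs G.m_assoc)
qed

section \<open>The framed Reidemeister pair attached to x\<close>

context
  fixes x
  assumes x [simp]: "x \<in> carrier G"
begin

abbreviation "\<phi> \<equiv> braiding_phi G br x"
abbreviation "\<psi> \<equiv> braiding_psi E G br x"

lemma under_colour_braiding_phi:
  assumes "X \<in> carrier G" "Y \<in> carrier G"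
  shows "under_colour G \<delta> \<phi> X Y
    = inv\<^bsub>G\<^esub> x \<otimes>\<^bsub>G\<^esub> Y \<otimes>\<^bsub>G\<^esub> inv\<^bsub>G\<^esub> X \<otimes>\<^bsub>G\<^esub> x \<otimes>\<^bsub>G\<^esub> X"
  using assms by (simp add: under_colour_def braiding_phi_def boundary_br gsimps)

text \<open>For M equal to the under colour of X and Y, the first slot of \<open>\<psi> X M\<close>
  collapses to \<open>Y x^-1\<close>, so the second factor inverts the first.\<close>

lemma braiding_R2:
  assumes "X \<in> carrier G" "Y \<in> carrier G"
  shows "\<phi> X Y \<otimes>\<^bsub>E\<^esub> \<psi> X (under_colour G \<delta> \<phi> X Y) = \<one>\<^bsub>E\<^esub>"
  using assms
  by (simp add: under_colour_braiding_phi) (simp add: braiding_phi_def braiding_psi_def gsimps)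

lemma braiding_R3:
  assumes [simp]: "X \<in> carrier G" "Y \<in> carrier G" "T \<in> carrier G"
  shows "\<phi> Y X \<otimes>\<^bsub>E\<^esub> (Y \<rhd> \<phi> T (under_colour G \<delta> \<phi> Y X)) \<otimes>\<^bsub>E\<^esub> \<phi> T Y
    = (X \<rhd> \<phi> T Y) \<otimes>\<^bsub>E\<^esub> \<phi> T X
      \<otimes>\<^bsub>E\<^esub> (T \<rhd> \<phi> (under_colour G \<delta> \<phi> T Y) (under_colour G \<delta> \<phi> T X))"
proof -
  define a b t where abt: "a = X \<otimes>\<^bsub>G\<^esub> inv\<^bsub>G\<^esub> x" "b = Y \<otimes>\<^bsub>G\<^esub> inv\<^bsub>G\<^esub> x" "t = T \<otimes>\<^bsub>G\<^esub> inv\<^bsub>G\<^esub> x"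
  have [simp]: "a \<in> carrier G" "b \<in> carrier G" "t \<in> carrier G"
    by (simp_all add: abt)
  have XYT: "X = a \<otimes>\<^bsub>G\<^esub> x" "Y = b \<otimes>\<^bsub>G\<^esub> x" "T = t \<otimes>\<^bsub>G\<^esub> x"
    by (simp_all add: abt H.m_assoc)
  show ?thesis
    \<comment> \<open>In \<open>X = a x\<close>, \<open>Y = b x\<close>, \<open>T = t x\<close> the
      factor x acts by conjugating both slots. With \<open>w = [t^-1, x]\<close>, this turns
      \<open>Z x^-1\<close> into \<open>a b^-1 v\<close>, \<open>W x^-1\<close> into aw and
      \<open>V x^-1\<close> into bw.\<close>
    using br_hexagon[of a b t "x \<otimes>\<^bsub>G\<^esub> b \<otimes>\<^bsub>G\<^esub> inv\<^bsub>G\<^esub> x" "br (inv\<^bsub>G\<^esub> t) x"]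
    unfolding XYT
    by (simp add: under_colour_braiding_phi)
      (simp add: braiding_phi_def act_mult act_br[of x] boundary_br gsimps)
qed

text \<open>The left side is Z times a conjugate of \<open>A Z^-1\<close>.\<close>

lemma boundary_braiding_phi_mult_eq_iff:
  assumes [simp]: "A \<in> carrier G" "Z \<in> carrier G"
  shows "\<delta> (\<phi> A Z) \<otimes>\<^bsub>G\<^esub> A = Z \<longleftrightarrow> A = Z"
proof -
  have "\<delta> (\<phi> A Z) \<otimes>\<^bsub>G\<^esub> A = Z \<otimes>\<^bsub>G\<^esub> (inv\<^bsub>G\<^esub> x \<otimes>\<^bsub>G\<^esub> A \<otimes>\<^bsub>G\<^esub> inv\<^bsub>G\<^esub> Z \<otimes>\<^bsub>G\<^esub> x)"
    by (simp add: braiding_phi_def boundary_br gsimps)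
  also have "\<dots> = Z \<longleftrightarrow> inv\<^bsub>G\<^esub> x \<otimes>\<^bsub>G\<^esub> (A \<otimes>\<^bsub>G\<^esub> inv\<^bsub>G\<^esub> Z) \<otimes>\<^bsub>G\<^esub> x = \<one>\<^bsub>G\<^esub>"
    by (simp add: H.m_assoc)
  also have "\<dots> \<longleftrightarrow> A \<otimes>\<^bsub>G\<^esub> inv\<^bsub>G\<^esub> Z = \<one>\<^bsub>G\<^esub>"
    by (metis H.inv_closed H.inv_m_cancel(1,2) H.l_one H.m_assoc H.m_closed H.r_inv H.r_one H.l_inv
        assms x)
  also have "\<dots> \<longleftrightarrow> A = Z"
    using H.inv_equality by force
  finally show ?thesis .
qed

lemma kink_f_braiding_phi: "Z \<in> carrier G \<Longrightarrow> kink_f G \<delta> \<phi> Z = Z"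
  unfolding kink_f_def by (rule the_equality) (auto simp: boundary_braiding_phi_mult_eq_iff)

text \<open>Both slots of \<open>\<psi> A A\<close> reduce to \<open>A x^-1\<close>, and a
  commutator of an element with itself is trivial.\<close>

lemma kink_g_braiding_psi: "A \<in> carrier G \<Longrightarrow> kink_g G \<delta> \<psi> A = A"
  by (simp add: kink_g_def braiding_psi_def boundary_br gsimps)

lemma framed_reidemeister_pair_braiding: "framed_reidemeister_pair E G \<delta> act \<psi> \<phi>"
proof -
  interpret crossed_module E G \<delta> act
    by (rule crossed_module_act)
  show ?thesis
  proof unfold_locales
    show "\<exists>!A. A \<in> carrier G \<and> \<delta> (\<phi> A Z) \<otimes>\<^bsub>G\<^esub> A = Z" if "Z \<in> carrier G" for Z
      using that by (auto simp: boundary_braiding_phi_mult_eq_iff)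
  qed (simp_all add: braiding_R2 braiding_R3 kink_f_braiding_phi kink_g_braiding_psi,
      simp_all add: braiding_phi_def braiding_psi_def)
qed

lemma framed_eisermann_lifting_braiding: "framed_eisermann_lifting E G \<delta> act \<psi> \<phi> x"
  using framed_reidemeister_pair_braiding
  by (auto simp: framed_eisermann_lifting_def framed_eisermann_lifting_axioms_def
      braiding_phi_def braiding_psi_def boundary_br)

end

end

theorem theorem4p32:
  fixes E :: "('e, 'm) monoid_scheme" and G :: "('g, 'n) monoid_scheme"
    and \<delta> :: "'e \<Rightarrow> 'g" and br :: "'g \<Rightarrow> 'g \<Rightarrow> 'e" and x :: 'g
  assumes "braided_crossed_module E G \<delta> br"
    and "x \<in> carrier G"
  shows "framed_reidemeister_pair E G \<delta> (braiding_act E G \<delta> br)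
      (braiding_psi E G br x) (braiding_phi G br x)
    \<and> framed_eisermann_lifting E G \<delta> (braiding_act E G \<delta> br)
      (braiding_psi E G br x) (braiding_phi G br x) x"
  using braided_crossed_module.framed_reidemeister_pair_braiding[OF assms]
    braided_crossed_module.framed_eisermann_lifting_braiding[OF assms] by blast

end
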